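(* Let $X_0\xrightarrow{\varphi}X_1\xleftarrow{\pi}Y\times X_0$ be a fully injective similarity scheme with $Y=\{1,\dots,N\}$ (discrete). Then its limit fixed point $X_\infty=Y^{\mathbb N}/\mathcal R_\infty$ is a Kameyama topological self-similar set (with surjection the quotient map $\pi^{\mathbb N}:Y^{\mathbb N}\to X_\infty$).
   Context: Kameyama topological self-similar set. A compact Hausdorff space $K$ is a topological self-similar set if there exist continuous maps $f_1,\dots,f_N:K\to K$ and a continuous surjection $\pi_K:\{1,\dots,N\}^{\mathbb N}\to K$ such that $\pi_K\circ W_k=f_k\circ\pi_K$ for all $k=1,\dots,N$, where $W_k(y_1,y_2,\dots)=(k,y_1,y_2,\dots)$. Similarity scheme. A similarity scheme $X_0\xrightarrow{\varphi}X_1\xleftarrow{\pi}Y\times X_0$ consists of compact Hausdorff spaces $X_0,X_1,Y$, a continuous injective map $\varphi:X_0\to X_1$ and a continuous surjective map $\pi:Y\times X_0\to X_1$. Tower. Put $\varphi_{1,0}=\varphi$, $\pi_{1,0}=\pi$. Inductively, for $n\ge1$, let $X_{n+1}=(Y\times X_n)/\sim$ (quotient topology; it is compact Hausdorff), where $(y,z)\sim(y',z')$ iff either $(y,z)=(y',z')$ or there are $x_0,x_0'\in X_0$ with $z=\varphi_{n,0}(x_0)$, $z'=\varphi_{n,0}(x_0')$, $\pi(y,x_0)=\pi(y',x_0')$; let $\pi_{1,n}:Y\times X_n\to X_{n+1}$ be the quotient map, and let $\varphi_{n+1,n}:X_n\to X_{n+1}$ be the (well-defined, continuous, injective) map with $\varphi_{n+1,n}(\pi_{1,n-1}(y,x))=\pi_{1,n}(y,\varphi_{n,n-1}(x))$.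 For $n\ge m$, $\varphi_{n,m}:X_m\to X_n$ is the composite $\varphi_{n,n-1}\circ\cdots\circ\varphi_{m+1,m}$ ($\varphi_{n,n}=\mathrm{id}$). Define $\pi_{p,q}:Y^p\times X_q\to X_{p+q}$ by $\pi_{0,q}=\mathrm{id}$ and $\pi_{p,q}=\pi_{p-1,q+1}\circ(\mathrm{id}_{Y^{p-1}}\times\pi_{1,q})$ for $p\ge1$. Limit space. For $(y_1,\dots,y_p)\in Y^p$ the cell is $C(y_1,\dots,y_p)=\{\pi_{p,0}(y_1,\dots,y_p,x):x\in X_0\}\subset X_p$ (for $p=0$ it is $X_0$). $Y^{\mathbb N}$ is the space of sequences $(y_1,y_2,\dots)$ in $Y$ with the product topology. For $x_n\in X_n$, $\Gamma_n(x_n)=\{(y_1,y_2,\dots)\in Y^{\mathbb N}:\varphi_{p,n}(x_n)\in C(y_1,\dots,y_p)\ \forall p\ge n\}$ (a nonempty closed set). The relation $\mathcal R$ on $Y^{\mathbb N}$: $u\,\mathcal R\,v$ iff $u=v$ or there are $n\ge0$ and $x_n\in X_n$ with $u,v\in\Gamma_n(x_n)$. $\mathcal R_\infty$ is the smallest equivalence relation containing $\mathcal R$; $X_\infty=Y^{\mathbb N}/\mathcal R_\infty$ has the quotient topology and $\pi^{\mathbb N}:Y^{\mathbb N}\to X_\infty$ is the quotient map. $\varphi_{\infty,n}:X_n\to X_\infty$ sends $x_n$ to the unique element of $\pi^{\mathbb N}(\Gamma_n(x_n))$. The scheme is fully injective if all $\varphi_{\infty,n}$, $n\ge0$, are injective.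 *)

theory Defs
  imports "HOL-Analysis.Analysis"
begin

section \<open>Quotient topologies\<close>

definition quotient_topology :: "'a topology \<Rightarrow> ('a \<Rightarrow> 'b) \<Rightarrow> 'b topology" where
  "quotient_topology X q =
     topology (\<lambda>U. U \<subseteq> q ` topspace X \<and> openin X {x \<in> topspace X. q x \<in> U})"

lemma openin_quotient_topology:
  "openin (quotient_topology X q) U \<longleftrightarrow>
     U \<subseteq> q ` topspace X \<and> openin X {x \<in> topspace X. q x \<in> U}"
proof -
  have "istopology (\<lambda>U. U \<subseteq> q ` topspace X \<and> openin X {x \<in> topspace X. q x \<in> U})"
    unfolding istopology_def
  proof (intro conjI allI impI; (elim conjE)?)
    fix S T assume "openin X {x \<in> topspace X. q x \<in> S}" "openin X {x \<in> topspace X. q x \<in> T}"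
    then have "openin X ({x \<in> topspace X. q x \<in> S} \<inter> {x \<in> topspace X. q x \<in> T})" by blast
    also have "{x \<in> topspace X. q x \<in> S} \<inter> {x \<in> topspace X. q x \<in> T} =
               {x \<in> topspace X. q x \<in> S \<inter> T}" by blast
    finally show "openin X {x \<in> topspace X. q x \<in> S \<inter> T}" .
  next
    fix \<K> assume *: "\<forall>U\<in>\<K>. U \<subseteq> q ` topspace X \<and> openin X {x \<in> topspace X. q x \<in> U}"
    then have "openin X (\<Union>U\<in>\<K>. {x \<in> topspace X. q x \<in> U})" by blast
    also have "(\<Union>U\<in>\<K>. {x \<in> topspace X. q x \<in> U}) = {x \<in> topspace X. q x \<in> \<Union>\<K>}" by blast
    finally show "openin X {x \<in> topspace X. q x \<in> \<Union>\<K>}" .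
  qed blast+
  then show ?thesis
    unfolding quotient_topology_def by (simp add: topology_inverse')
qed

lemma topspace_quotient_topology [simp]:
  "topspace (quotient_topology X q) = q ` topspace X"
proof
  show "topspace (quotient_topology X q) \<subseteq> q ` topspace X"
    using openin_topspace[of "quotient_topology X q"]
    by (simp only: openin_quotient_topology)
  have "{x \<in> topspace X. q x \<in> q ` topspace X} = topspace X" by blast
  then have "openin (quotient_topology X q) (q ` topspace X)"
    by (simp add: openin_quotient_topology)
  then show "q ` topspace X \<subseteq> topspace (quotient_topology X q)"
    by (rule openin_subset)
qed

lemma quotient_map_quotient_topology: "quotient_map X (quotient_topology X q) q"
  unfolding quotient_map_def by (simp add: openin_quotient_topology)


section \<open>Topological self-similar sets\<close>

text \<open>Sequences \<open>(y\<^sub>1, y\<^sub>2, \<dots>)\<close> are functions on \<^typ>\<open>nat\<close>, with \<open>y\<^sub>1\<close> at index \<open>0\<close>.\<close>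

definition seq_space :: "'y topology \<Rightarrow> (nat \<Rightarrow> 'y) topology" where
  "seq_space Y = product_topology (\<lambda>_. Y) UNIV"

definition shift_in :: "'y \<Rightarrow> (nat \<Rightarrow> 'y) \<Rightarrow> (nat \<Rightarrow> 'y)" where
  "shift_in k u = (\<lambda>i. case i of 0 \<Rightarrow> k | Suc j \<Rightarrow> u j)"

definition self_similar_via :: "nat \<Rightarrow> 'k topology \<Rightarrow> ((nat \<Rightarrow> nat) \<Rightarrow> 'k) \<Rightarrow> bool" where
  "self_similar_via N K p \<longleftrightarrow>
     compact_space K \<and> Hausdorff_space K \<and>
     continuous_map (seq_space (discrete_topology {1..N})) K p \<and>
     p ` topspace (seq_space (discrete_topology {1..N})) = topspace K \<and>
     (\<exists>f :: nat \<Rightarrow> 'k \<Rightarrow> 'k. \<forall>k\<in>{1..N}.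
        continuous_map K K (f k) \<and>
        (\<forall>u \<in> topspace (seq_space (discrete_topology {1..N})). p (shift_in k u) = f k (p u)))"

definition topological_self_similar_set :: "'k topology \<Rightarrow> bool" where
  "topological_self_similar_set K \<longleftrightarrow> (\<exists>N p. self_similar_via N K p)"


section \<open>Similarity schemes\<close>

record ('a, 'b, 'y) scheme =
  space0 :: "'a topology"
  space1 :: "'b topology"
  digits :: "'y topology"
  embed :: "'a \<Rightarrow> 'b"
  proj :: "'y \<times> 'a \<Rightarrow> 'b"

definition similarity_scheme :: "('a, 'b, 'y) scheme \<Rightarrow> bool" where
  "similarity_scheme S \<longleftrightarrow>
     compact_space (space0 S) \<and> Hausdorff_space (space0 S) \<and>
     compact_space (space1 S) \<and> Hausdorff_space (space1 S) \<and>
     compact_space (digits S) \<and> Hausdorff_space (digits S) \<and>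
     continuous_map (space0 S) (space1 S) (embed S) \<and>
     inj_on (embed S) (topspace (space0 S)) \<and>
     continuous_map (prod_topology (digits S) (space0 S)) (space1 S) (proj S) \<and>
     proj S ` topspace (prod_topology (digits S) (space0 S)) = topspace (space1 S)"


section \<open>The tower\<close>

text \<open>
  All spaces of the tower live on one type of points: \<open>Pt0\<close> and \<open>Pt1\<close> carry copies of \<open>X\<^sub>0\<close> and
  \<open>X\<^sub>1\<close>. For \<open>n \<ge> 1\<close> an equivalence class in \<open>X\<^bsub>n+1\<^esub> = (Y \<times> X\<^sub>n)/\<sim>\<close> cannot be a set of points of
  that same type, so it is represented by a chosen member \<open>(y, z)\<close>, stored as \<open>Node y z\<close>; lemma
  \<open>pi1_eq_iff\<close> below shows that two pairs get the same representative iff they are equivalent.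
\<close>

datatype ('a, 'b, 'y) point =
  Pt0 (un0: 'a) | Pt1 (un1: 'b) | Node 'y "('a, 'b, 'y) point"

text \<open>
  The relation \<open>\<sim>\<close> on \<open>Y \<times> X\<^sub>n\<close>; the arguments \<open>T\<close> and \<open>g\<close> stand for \<open>X\<^sub>n\<close> and \<open>\<phi>\<^bsub>n,0\<^esub>\<close>.
\<close>

definition glue ::
  "('a, 'b, 'y) scheme \<Rightarrow> ('a, 'b, 'y) point topology \<Rightarrow>
   (('a, 'b, 'y) point \<Rightarrow> ('a, 'b, 'y) point) \<Rightarrow>
   (('y \<times> ('a, 'b, 'y) point) \<times> ('y \<times> ('a, 'b, 'y) point)) set" where
  "glue S T g =
     {((y, z), (y', z')).
        (y, z) \<in> topspace (prod_topology (digits S) T) \<and>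
        (y', z') \<in> topspace (prod_topology (digits S) T) \<and>
        ((y, z) = (y', z') \<or>
         (\<exists>x \<in> topspace (space0 S). \<exists>x' \<in> topspace (space0 S).
            z = g (Pt0 x) \<and> z' = g (Pt0 x') \<and> proj S (y, x) = proj S (y', x')))}"

text \<open>
  \<open>tower S n\<close> is \<open>X\<^sub>n\<close>, \<open>pi1 S n\<close> is \<open>\<pi>\<^bsub>1,n\<^esub>\<close>, \<open>phi1 S n\<close> is \<open>\<phi>\<^bsub>n+1,n\<^esub>\<close>, and
  \<open>phi S n m\<close> is \<open>\<phi>\<^bsub>n,m\<^esub>\<close> (meaningful for \<open>m \<le> n\<close> only).
\<close>

function (sequential)
      tower :: "('a, 'b, 'y) scheme \<Rightarrow> nat \<Rightarrow> ('a, 'b, 'y) point topology"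
  and phi :: "('a, 'b, 'y) scheme \<Rightarrow> nat \<Rightarrow> nat \<Rightarrow> ('a, 'b, 'y) point \<Rightarrow> ('a, 'b, 'y) point"
  and pi1 :: "('a, 'b, 'y) scheme \<Rightarrow> nat \<Rightarrow> 'y \<times> ('a, 'b, 'y) point \<Rightarrow> ('a, 'b, 'y) point"
  and phi1 :: "('a, 'b, 'y) scheme \<Rightarrow> nat \<Rightarrow> ('a, 'b, 'y) point \<Rightarrow> ('a, 'b, 'y) point"
where
  "tower S 0 = quotient_topology (space0 S) Pt0"
| "tower S (Suc 0) = quotient_topology (space1 S) Pt1"
| "tower S (Suc (Suc n)) =
     quotient_topology (prod_topology (digits S) (tower S (Suc n))) (pi1 S (Suc n))"
| "phi S 0 m = id"
| "phi S (Suc n) m = (if m = Suc n then id else phi1 S n \<circ> phi S n m)"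
| "pi1 S 0 = (\<lambda>(y, z). Pt1 (proj S (y, un0 z)))"
| "pi1 S (Suc n) =
     (\<lambda>p. let (y, z) = (SOME p'. (p, p') \<in> glue S (tower S (Suc n)) (phi S (Suc n) 0))
          in Node y z)"
| "phi1 S 0 = (\<lambda>z. Pt1 (embed S (un0 z)))"
| "phi1 S (Suc n) =
     (\<lambda>w. let (y, z) = inv_into (topspace (prod_topology (digits S) (tower S n))) (pi1 S n) w
          in pi1 S (Suc n) (y, phi1 S n z))"
  by pat_completeness auto
termination
  by (relation "Wellfounded.measure (\<lambda>a. case a of
        Inl (Inl (S, n)) \<Rightarrow> 4 * n
      | Inl (Inr (S, n, m)) \<Rightarrow> 4 * n
      | Inr (Inl (S, n)) \<Rightarrow> 4 * n + 1
      | Inr (Inr (S, n)) \<Rightarrow> 4 * n + 2)") auto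

text \<open>\<open>pi_pq S p q ys x\<close> is \<open>\<pi>\<^bsub>p,q\<^esub>(y\<^sub>1, \<dots>, y\<^sub>p, x)\<close> for a list \<open>ys\<close> of length \<open>p\<close>.\<close>

primrec pi_pq ::
  "('a, 'b, 'y) scheme \<Rightarrow> nat \<Rightarrow> nat \<Rightarrow> 'y list \<Rightarrow> ('a, 'b, 'y) point \<Rightarrow> ('a, 'b, 'y) point" where
  "pi_pq S 0 q ys x = x"
| "pi_pq S (Suc p) q ys x = pi_pq S p (Suc q) (butlast ys) (pi1 S q (last ys, x))"


section \<open>The limit space\<close>

definition tower_cell :: "('a, 'b, 'y) scheme \<Rightarrow> 'y list \<Rightarrow> ('a, 'b, 'y) point set" where
  "tower_cell S ys = pi_pq S (length ys) 0 ys ` topspace (tower S 0)"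

definition Gamma_set :: "('a, 'b, 'y) scheme \<Rightarrow> nat \<Rightarrow> ('a, 'b, 'y) point \<Rightarrow> (nat \<Rightarrow> 'y) set" where
  "Gamma_set S n x =
     {u \<in> topspace (seq_space (digits S)). \<forall>p\<ge>n. phi S p n x \<in> tower_cell S (map u [0..<p])}"

definition rel_R :: "('a, 'b, 'y) scheme \<Rightarrow> ((nat \<Rightarrow> 'y) \<times> (nat \<Rightarrow> 'y)) set" where
  "rel_R S =
     {(u, v). u \<in> topspace (seq_space (digits S)) \<and> v \<in> topspace (seq_space (digits S)) \<and>
        (u = v \<or> (\<exists>n. \<exists>x \<in> topspace (tower S n). u \<in> Gamma_set S n x \<and> v \<in> Gamma_set S n x))}"

definition rel_R_inf :: "('a, 'b, 'y) scheme \<Rightarrow> ((nat \<Rightarrow> 'y) \<times> (nat \<Rightarrow> 'y)) set" where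
  "rel_R_inf S = \<Inter>{E. equiv (topspace (seq_space (digits S))) E \<and> rel_R S \<subseteq> E}"

definition pi_seq :: "('a, 'b, 'y) scheme \<Rightarrow> (nat \<Rightarrow> 'y) \<Rightarrow> (nat \<Rightarrow> 'y) set" where
  "pi_seq S u = rel_R_inf S `` {u}"

definition limit_space :: "('a, 'b, 'y) scheme \<Rightarrow> (nat \<Rightarrow> 'y) set topology" where
  "limit_space S = quotient_topology (seq_space (digits S)) (pi_seq S)"

definition phi_inf ::
  "('a, 'b, 'y) scheme \<Rightarrow> nat \<Rightarrow> ('a, 'b, 'y) point \<Rightarrow> (nat \<Rightarrow> 'y) set" where
  "phi_inf S n x = the_elem (pi_seq S ` Gamma_set S n x)"

definition fully_injective :: "('a, 'b, 'y) scheme \<Rightarrow> bool" where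
  "fully_injective S \<longleftrightarrow> (\<forall>n. inj_on (phi_inf S n) (topspace (tower S n)))"


section \<open>The tower is the intended one\<close>

lemma topspace_limit_space:
  "topspace (limit_space S) = topspace (seq_space (digits S)) // rel_R_inf S"
  by (auto simp: limit_space_def quotient_def pi_seq_def)

lemma equiv_rel_R_inf: "equiv (topspace (seq_space (digits S))) (rel_R_inf S)"
proof -
  let ?A = "topspace (seq_space (digits S))"
  have "equiv ?A (?A \<times> ?A)"
    by (auto simp: equiv_def refl_on_def sym_def trans_def)
  moreover have "rel_R S \<subseteq> ?A \<times> ?A" by (auto simp: rel_R_def)
  ultimately have "?A \<times> ?A \<in> {E. equiv ?A E \<and> rel_R S \<subseteq> E}" by blast
  then have "rel_R_inf S \<subseteq> ?A \<times> ?A" unfolding rel_R_inf_def by (rule Inter_lower)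
  moreover have "refl_on ?A (rel_R_inf S)"
    unfolding rel_R_inf_def by (auto simp: refl_on_def equiv_def)
  moreover have "sym (rel_R_inf S)"
    unfolding rel_R_inf_def by (rule symI) (auto simp: equiv_def dest: symD)
  moreover have "trans (rel_R_inf S)"
    unfolding rel_R_inf_def by (rule transI) (auto simp: equiv_def elim: transE)
  ultimately show ?thesis by (rule equivI)
qed

lemma equiv_glue:
  assumes "inj_on (\<lambda>x. g (Pt0 x)) (topspace (space0 S))"
  shows "equiv (topspace (prod_topology (digits S) T)) (glue S T g)"
proof (rule equivI)
  show "glue S T g \<subseteq> topspace (prod_topology (digits S) T) \<times> topspace (prod_topology (digits S) T)"
    by (auto simp: glue_def)
  show "refl_on (topspace (prod_topology (digits S) T)) (glue S T g)"
    by (auto simp: refl_on_def glue_def)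
  show "sym (glue S T g)"
    by (rule symI, clarsimp simp: glue_def) metis
  show "trans (glue S T g)"
    using assms by (intro transI, clarsimp simp: glue_def inj_on_def) metis
qed

lemma tower_Suc_topspace:
  assumes "similarity_scheme S"
  shows "topspace (tower S (Suc n)) =
         pi1 S n ` topspace (prod_topology (digits S) (tower S n))"
proof (cases n)
  case 0
  have "topspace (space1 S) = proj S ` (topspace (digits S) \<times> topspace (space0 S))"
    using assms by (auto simp: similarity_scheme_def)
  then show ?thesis using 0 by (force simp: image_iff)
qed simp

lemma equiv_SOME_eq:
  assumes "equiv A r" "p \<in> A" "q \<in> A"
  shows "(SOME a. (p, a) \<in> r) = (SOME a. (q, a) \<in> r) \<longleftrightarrow> (p, q) \<in> r"
proof
  assume eq: "(SOME a. (p, a) \<in> r) = (SOME a. (q, a) \<in> r)"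
  have "(p, p) \<in> r" "(q, q) \<in> r"
    using assms by (auto simp: equiv_def refl_on_def)
  then have "(p, SOME a. (p, a) \<in> r) \<in> r" "(q, SOME a. (q, a) \<in> r) \<in> r"
    by (auto intro: someI)
  then show "(p, q) \<in> r"
    using eq assms(1) by (metis equivE symD transD)
next
  assume "(p, q) \<in> r"
  then have "r `` {p} = r `` {q}" using assms(1) by (simp add: equiv_class_eq)
  then have "(\<lambda>a. (p, a) \<in> r) = (\<lambda>a. (q, a) \<in> r)" by auto
  then show "(SOME a. (p, a) \<in> r) = (SOME a. (q, a) \<in> r)" by simp
qed

lemma pi1_eq_iff_aux:
  assumes "inj_on (\<lambda>x. phi S (Suc n) 0 (Pt0 x)) (topspace (space0 S))"
    and "p \<in> topspace (prod_topology (digits S) (tower S (Suc n)))"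
    and "q \<in> topspace (prod_topology (digits S) (tower S (Suc n)))"
  shows "pi1 S (Suc n) p = pi1 S (Suc n) q \<longleftrightarrow>
         (p, q) \<in> glue S (tower S (Suc n)) (phi S (Suc n) 0)"
proof -
  have "pi1 S (Suc n) p = pi1 S (Suc n) q \<longleftrightarrow>
        (SOME a. (p, a) \<in> glue S (tower S (Suc n)) (phi S (Suc n) 0)) =
        (SOME a. (q, a) \<in> glue S (tower S (Suc n)) (phi S (Suc n) 0))"
    by (simp only: pi1.simps Let_def case_prod_unfold point.inject prod_eq_iff)
  then show ?thesis
    unfolding equiv_SOME_eq[OF equiv_glue[OF assms(1)] assms(2,3)] .
qed

lemma tower_invariant:
  assumes S: "similarity_scheme S"
  shows "inj_on (phi1 S n) (topspace (tower S n)) \<and>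
         phi1 S n ` topspace (tower S n) \<subseteq> topspace (tower S (Suc n)) \<and>
         inj_on (\<lambda>x. phi S n 0 (Pt0 x)) (topspace (space0 S)) \<and>
         (\<forall>x \<in> topspace (space0 S). phi S n 0 (Pt0 x) \<in> topspace (tower S n)) \<and>
         (\<forall>m y z. n = Suc m \<longrightarrow> y \<in> topspace (digits S) \<longrightarrow> z \<in> topspace (tower S m) \<longrightarrow>
            phi1 S n (pi1 S m (y, z)) = pi1 S n (y, phi1 S m z))"
proof (induction n)
  case 0
  have "embed S ` topspace (space0 S) \<subseteq> topspace (space1 S)" "inj_on (embed S) (topspace (space0 S))"
    using S by (auto simp: similarity_scheme_def continuous_map_def)
  then show ?case by (auto simp: inj_on_def)
next
  case (Suc n)
  let ?P = "topspace (digits S) \<times> topspace (tower S n)"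
  have inj1: "inj_on (phi1 S n) (topspace (tower S n))"
    and im1: "phi1 S n ` topspace (tower S n) \<subseteq> topspace (tower S (Suc n))"
    and inj0: "inj_on (\<lambda>x. phi S n 0 (Pt0 x)) (topspace (space0 S))"
    and in0: "\<And>x. x \<in> topspace (space0 S) \<Longrightarrow> phi S n 0 (Pt0 x) \<in> topspace (tower S n)"
    using Suc.IH by auto
  have phi_Suc: "phi S (Suc n) 0 w = phi1 S n (phi S n 0 w)" for w by simp
  have inj0': "inj_on (\<lambda>x. phi S (Suc n) 0 (Pt0 x)) (topspace (space0 S))"
    unfolding phi_Suc using inj1 inj0 in0 by (simp add: inj_on_def)
  have in0': "phi S (Suc n) 0 (Pt0 x) \<in> topspace (tower S (Suc n))"
    if "x \<in> topspace (space0 S)" for x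
    unfolding phi_Suc using im1 in0[OF that] by blast
  have key: "pi1 S n (y, z) = pi1 S n (y', z') \<longleftrightarrow>
      pi1 S (Suc n) (y, phi1 S n z) = pi1 S (Suc n) (y', phi1 S n z')"
    if "(y, z) \<in> ?P" "(y', z') \<in> ?P" for y z y' z'
  proof -
    have z: "z \<in> topspace (tower S n)" "z' \<in> topspace (tower S n)"
      "y \<in> topspace (digits S)" "y' \<in> topspace (digits S)"
      using that by auto
    have R: "pi1 S (Suc n) (y, phi1 S n z) = pi1 S (Suc n) (y', phi1 S n z') \<longleftrightarrow>
        (y, phi1 S n z) = (y', phi1 S n z') \<or>
        (\<exists>x \<in> topspace (space0 S). \<exists>x' \<in> topspace (space0 S).
           phi1 S n z = phi1 S n (phi S n 0 (Pt0 x)) \<and>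
           phi1 S n z' = phi1 S n (phi S n 0 (Pt0 x')) \<and> proj S (y, x) = proj S (y', x'))"
    proof (subst pi1_eq_iff_aux[OF inj0'])
      show "(y, phi1 S n z) \<in> topspace (prod_topology (digits S) (tower S (Suc n)))"
        "(y', phi1 S n z') \<in> topspace (prod_topology (digits S) (tower S (Suc n)))"
        using im1 z by auto
      then show "((y, phi1 S n z), (y', phi1 S n z'))
           \<in> glue S (tower S (Suc n)) (phi S (Suc n) 0) \<longleftrightarrow>
        (y, phi1 S n z) = (y', phi1 S n z') \<or>
        (\<exists>x \<in> topspace (space0 S). \<exists>x' \<in> topspace (space0 S).
           phi1 S n z = phi1 S n (phi S n 0 (Pt0 x)) \<and>
           phi1 S n z' = phi1 S n (phi S n 0 (Pt0 x')) \<and> proj S (y, x) = proj S (y', x'))"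
        unfolding glue_def phi_Suc by simp
    qed
    have R': "\<dots> \<longleftrightarrow> (y, z) = (y', z') \<or>
        (\<exists>x \<in> topspace (space0 S). \<exists>x' \<in> topspace (space0 S).
           z = phi S n 0 (Pt0 x) \<and> z' = phi S n 0 (Pt0 x') \<and> proj S (y, x) = proj S (y', x'))"
      using inj_on_eq_iff[OF inj1] z in0 by (simp cong: bex_cong)
    have L: "pi1 S n (y, z) = pi1 S n (y', z') \<longleftrightarrow> (y, z) = (y', z') \<or>
        (\<exists>x \<in> topspace (space0 S). \<exists>x' \<in> topspace (space0 S).
           z = phi S n 0 (Pt0 x) \<and> z' = phi S n 0 (Pt0 x') \<and> proj S (y, x) = proj S (y', x'))"
    proof (cases n)
      case 0
      then show ?thesis using z by auto
    next
      case (Suc k)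
      show ?thesis
        unfolding Suc
      proof (subst pi1_eq_iff_aux)
        show "inj_on (\<lambda>x. phi S (Suc k) 0 (Pt0 x)) (topspace (space0 S))"
          using inj0 unfolding Suc .
        show yz: "(y, z) \<in> topspace (prod_topology (digits S) (tower S (Suc k)))"
          "(y', z') \<in> topspace (prod_topology (digits S) (tower S (Suc k)))"
          using z unfolding Suc topspace_prod_topology by blast+
        show "((y, z), (y', z')) \<in> glue S (tower S (Suc k)) (phi S (Suc k) 0) \<longleftrightarrow>
          (y, z) = (y', z') \<or>
          (\<exists>x \<in> topspace (space0 S). \<exists>x' \<in> topspace (space0 S).
             z = phi S (Suc k) 0 (Pt0 x) \<and> z' = phi S (Suc k) 0 (Pt0 x') \<and>
             proj S (y, x) = proj S (y', x'))"
          unfolding glue_def using yz by (simp del: phi.simps tower.simps)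
      qed
    qed
    show ?thesis unfolding L R R' ..
  qed
  have eqv: "phi1 S (Suc n) (pi1 S n (y, z)) = pi1 S (Suc n) (y, phi1 S n z)"
    if "(y, z) \<in> ?P" for y z
  proof -
    obtain a b where ab: "inv_into ?P (pi1 S n) (pi1 S n (y, z)) = (a, b)" by fastforce
    have "(a, b) \<in> ?P" "pi1 S n (a, b) = pi1 S n (y, z)"
      using inv_into_into[of "pi1 S n (y, z)" "pi1 S n" ?P]
        f_inv_into_f[of "pi1 S n (y, z)" "pi1 S n" ?P] that ab by auto
    then have "pi1 S (Suc n) (a, phi1 S n b) = pi1 S (Suc n) (y, phi1 S n z)"
      using key that by blast
    then show ?thesis
      by (simp only: phi1.simps topspace_prod_topology ab Let_def prod.case)
  qed
  have surj: "\<exists>y z. (y, z) \<in> ?P \<and> w = pi1 S n (y, z)" if "w \<in> topspace (tower S (Suc n))" for w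
    using that unfolding tower_Suc_topspace[OF S] by auto
  have injS: "inj_on (phi1 S (Suc n)) (topspace (tower S (Suc n)))"
    by (rule inj_onI) (metis surj key eqv)
  have imS: "phi1 S (Suc n) w \<in> topspace (tower S (Suc (Suc n)))"
    if "w \<in> topspace (tower S (Suc n))" for w
  proof -
    obtain y z where yz: "(y, z) \<in> ?P" "w = pi1 S n (y, z)" using surj[OF \<open>w \<in> _\<close>] by blast
    have "(y, phi1 S n z) \<in> topspace (digits S) \<times> topspace (tower S (Suc n))"
      using yz im1 by blast
    then show ?thesis
      unfolding tower_Suc_topspace[OF S, of "Suc n"] topspace_prod_topology yz(2) eqv[OF yz(1)]
      by (rule imageI)
  qed
  show ?case
    using injS imS inj0' in0' eqv by (auto simp del: phi1.simps pi1.simps phi.simps tower.simps)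
qed

theorem pi1_eq_iff:
  assumes "similarity_scheme S" and "n \<ge> 1"
    and "p \<in> topspace (prod_topology (digits S) (tower S n))"
    and "q \<in> topspace (prod_topology (digits S) (tower S n))"
  shows "pi1 S n p = pi1 S n q \<longleftrightarrow> (p, q) \<in> glue S (tower S n) (phi S n 0)"
proof -
  obtain m where m: "n = Suc m" using assms(2) by (cases n) auto
  show ?thesis
    using pi1_eq_iff_aux[of S m p q] tower_invariant[OF assms(1), of n] assms(3,4)
    unfolding m by blast
qed

theorem phi1_inj_on:
  "similarity_scheme S \<Longrightarrow> inj_on (phi1 S n) (topspace (tower S n))"
  using tower_invariant by blast

theorem phi1_pi1:
  assumes "similarity_scheme S" "y \<in> topspace (digits S)" "z \<in> topspace (tower S n)"
  shows "phi1 S (Suc n) (pi1 S n (y, z)) = pi1 S (Suc n) (y, phi1 S n z)"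
  using tower_invariant[OF assms(1), of "Suc n"] assms(2,3) by blast

end

theory Submission
  imports Defs
begin

text \<open>
  The digit maps \<open>W\<^sub>k\<close> send \<open>\<Gamma>\<^sub>n(x)\<close> into \<open>\<Gamma>\<^bsub>n+1\<^esub>(\<pi>\<^bsub>1,n\<^esub>(k, x))\<close>, hence descend to \<open>X\<^sub>\<infinity>\<close>; the point is
  that \<open>X\<^sub>\<infinity>\<close> is Hausdorff. Since \<open>\<Gamma>\<^sub>m(\<phi>\<^bsub>m,n\<^esub>(x)) = \<Gamma>\<^sub>n(x)\<close>, full injectivity makes \<open>R\<close> itself
  transitive, so \<open>R\<^sub>\<infinity> = R\<close>. The part \<open>R\<^sub>p\<close> of \<open>R\<close> witnessed by points of \<open>X\<^sub>p\<close> is closed, being a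
  projection along the compact space \<open>X\<^sub>p\<close>. Two distinct cells of level \<open>p\<close> meet, at every later
  level, only in points coming from \<open>X\<^sub>p\<close>, so \<open>R\<close> and \<open>R\<^sub>p\<close> agree on pairs with different prefixes
  of length \<open>p\<close>. Hence \<open>R\<close> is closed.
\<close>

section \<open>Quotients of compact Hausdorff spaces\<close>

lemma Hausdorff_space_quotient_by_closed_kernel:
  assumes "compact_space X" "Hausdorff_space X" and q: "quotient_map X Z q"
    and ker: "closedin (prod_topology X X) {(a, b) \<in> topspace X \<times> topspace X. q a = q b}"
  shows "Hausdorff_space Z"
proof -
  let ?K = "{(a, b) \<in> topspace X \<times> topspace X. q a = q b}"
  have surj: "q ` topspace X = topspace Z" and
    clo: "\<And>U. U \<subseteq> topspace Z \<Longrightarrow> closedin X {x \<in> topspace X. q x \<in> U} \<longleftrightarrow> closedin Z U"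
    using q by (auto simp: quotient_map_closedin)
  have "closedin Z (q ` A)" if A: "closedin X A" for A
  proof -
    have "A \<subseteq> topspace X" using A closedin_subset by blast
    have "closedin (prod_topology X X) (?K \<inter> A \<times> topspace X)"
      using ker A by (intro closedin_Int) (auto simp: closedin_prod_Times_iff)
    then have "closedin X (snd ` (?K \<inter> A \<times> topspace X))"
      using Abstract_Topological_Spaces.closed_map_snd[OF \<open>compact_space X\<close>]
      by (auto simp: closed_map_def)
    also have "snd ` (?K \<inter> A \<times> topspace X) = {x \<in> topspace X. q x \<in> q ` A}"
    proof (intro equalityI subsetI)
      fix x assume "x \<in> {x \<in> topspace X. q x \<in> q ` A}"
      then obtain a where "a \<in> A" "q x = q a" "x \<in> topspace X" by blast
      then have "(a, x) \<in> ?K \<inter> A \<times> topspace X" using \<open>A \<subseteq> topspace X\<close> by auto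
      then show "x \<in> snd ` (?K \<inter> A \<times> topspace X)" by (rule image_eqI[rotated]) simp
    next
      fix x assume "x \<in> snd ` (?K \<inter> A \<times> topspace X)"
      then obtain a where "a \<in> A" "x \<in> topspace X" "q a = q x" by auto
      then show "x \<in> {x \<in> topspace X. q x \<in> q ` A}" by (auto intro: image_eqI[of _ _ a])
    qed
    finally show ?thesis
      using clo[of "q ` A"] surj \<open>A \<subseteq> topspace X\<close> by blast
  qed
  then have "closed_map X Z q" by (simp add: closed_map_def)
  then show ?thesis
    using normal_Hausdorff_space_closed_continuous_map_image[of X Z q]
      compact_Hausdorff_or_regular_imp_normal_space[of X] assms surj
      quotient_imp_continuous_map[OF q] by blast
qed

lemma compact_space_quotient_map_image:
  assumes "compact_space X" "quotient_map X Z q"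
  shows "compact_space Z"
  using assms image_compactin[of X "topspace X" Z q] quotient_imp_continuous_map[of X Z q]
    quotient_imp_surjective_map[of X Z q] by (simp add: compact_space_def)

section \<open>The spaces of the tower\<close>

declare tower.simps [simp del] phi.simps [simp del] pi1.simps [simp del] phi1.simps [simp del]

lemma phi_refl [simp]: "phi S n n = id"
  by (cases n) (simp_all add: phi.simps)

lemma phi_Suc: "m \<le> n \<Longrightarrow> phi S (Suc n) m x = phi1 S n (phi S n m x)"
  by (simp add: phi.simps)

lemma phi_trans: "\<lbrakk>m \<le> n; n \<le> p\<rbrakk> \<Longrightarrow> phi S p n (phi S n m x) = phi S p m x"
proof (induction p)
  case (Suc p)
  then show ?case by (cases "n = Suc p") (simp_all add: phi_Suc)
qed simp

lemma phi1_in_tower: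
  "\<lbrakk>similarity_scheme S; z \<in> topspace (tower S n)\<rbrakk> \<Longrightarrow> phi1 S n z \<in> topspace (tower S (Suc n))"
  using tower_invariant[of S n] by blast

lemma phi_in_tower:
  assumes "similarity_scheme S" "m \<le> n" "z \<in> topspace (tower S m)"
  shows "phi S n m z \<in> topspace (tower S n)"
  using assms(2) by (induction n rule: dec_induct) (simp_all add: phi_Suc phi1_in_tower assms)

lemma pi1_in_tower:
  assumes "similarity_scheme S" "y \<in> topspace (digits S)" "z \<in> topspace (tower S n)"
  shows "pi1 S n (y, z) \<in> topspace (tower S (Suc n))"
  using assms tower_Suc_topspace[of S n] by auto

lemma tower_0_topspace: "topspace (tower S 0) = Pt0 ` topspace (space0 S)"
  by (simp add: tower.simps)

lemma phi_pi1:
  assumes S: "similarity_scheme S" and "m \<le> n" "y \<in> topspace (digits S)" "z \<in> topspace (tower S m)"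
  shows "phi S (Suc n) (Suc m) (pi1 S m (y, z)) = pi1 S n (y, phi S n m z)"
  using \<open>m \<le> n\<close>
proof (induction n rule: dec_induct)
  case (step n)
  then show ?case using assms by (simp add: phi_Suc phi1_pi1 phi_in_tower)
qed simp

lemma pi1_eq_pi1_iff:
  assumes S: "similarity_scheme S"
    and "y \<in> topspace (digits S)" "z \<in> topspace (tower S n)"
    and "y' \<in> topspace (digits S)" "z' \<in> topspace (tower S n)"
  shows "pi1 S n (y, z) = pi1 S n (y', z') \<longleftrightarrow>
    (y, z) = (y', z') \<or>
    (\<exists>x \<in> topspace (space0 S). \<exists>x' \<in> topspace (space0 S).
       z = phi S n 0 (Pt0 x) \<and> z' = phi S n 0 (Pt0 x') \<and> proj S (y, x) = proj S (y', x'))"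
proof (cases n)
  case 0
  then show ?thesis using assms by (auto simp: pi1.simps tower.simps)
next
  case (Suc m)
  then show ?thesis using pi1_eq_iff[OF S, of n "(y, z)" "(y', z')"] assms by (simp add: glue_def)
qed

lemma homeomorphic_space_quotient_topology:
  assumes "inj_on f (topspace X)"
  shows "X homeomorphic_space quotient_topology X f"
  using assms quotient_map_quotient_topology[of X f]
  by (intro homeomorphic_map_imp_homeomorphic_space[of _ _ f]) (simp add: homeomorphic_map_def)

lemma continuous_map_quotient_topology: "continuous_map X (quotient_topology X f) f"
  by (simp add: quotient_imp_continuous_map quotient_map_quotient_topology)

lemma closedin_kernel_pi1:
  assumes S: "similarity_scheme S"
    and H: "Hausdorff_space (prod_topology (digits S) (tower S n))"
    and \<phi>: "continuous_map (space0 S) (tower S n) (\<lambda>x. phi S n 0 (Pt0 x))"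
  defines "P \<equiv> prod_topology (digits S) (tower S n)"
  shows "closedin (prod_topology P P) {(a, b) \<in> topspace P \<times> topspace P. pi1 S n a = pi1 S n b}"
proof -
  let ?Q = "prod_topology (digits S) (space0 S)"
  let ?g = "\<lambda>(y, x). (y, phi S n 0 (Pt0 x))"
  have H0: "Hausdorff_space (space1 S)" "compact_space ?Q"
    and \<pi>: "continuous_map ?Q (space1 S) (proj S)"
    using S by (auto simp: similarity_scheme_def compact_space_prod_topology)
  have g: "continuous_map ?Q P ?g"
    using \<phi> by (auto simp: P_def continuous_map_prod_top)
  have gg: "closed_map (prod_topology ?Q ?Q) (prod_topology P P) (\<lambda>(a, b). (?g a, ?g b))"
    using g H H0 by (intro continuous_imp_closed_map)
      (auto simp: continuous_map_prod_top Hausdorff_space_prod_topology compact_space_prod_topology P_def)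
  have "closedin (prod_topology ?Q ?Q)
      {c \<in> topspace (prod_topology ?Q ?Q). (proj S \<circ> fst) c = (proj S \<circ> snd) c}"
    by (intro closedin_continuous_maps_eq[OF H0(1)] continuous_map_compose[OF _ \<pi>]
        continuous_map_fst continuous_map_snd)
  then have "closedin (prod_topology P P) ((\<lambda>(a, b). (?g a, ?g b)) `
      {c \<in> topspace (prod_topology ?Q ?Q). (proj S \<circ> fst) c = (proj S \<circ> snd) c})" (is "closedin _ ?G")
    using gg unfolding closed_map_def by blast
  moreover have "closedin (prod_topology P P) ((\<lambda>x. (x, x)) ` topspace P)"
    using H by (simp add: P_def Hausdorff_space_closedin_diagonal)
  ultimately have "closedin (prod_topology P P) ((\<lambda>x. (x, x)) ` topspace P \<union> ?G)"
    by (rule closedin_Un[rotated])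
  also have "(\<lambda>x. (x, x)) ` topspace P \<union> ?G = {(a, b) \<in> topspace P \<times> topspace P. pi1 S n a = pi1 S n b}"
  proof (rule set_eqI)
    fix c :: "('c \<times> ('a, 'b, 'c) point) \<times> ('c \<times> ('a, 'b, 'c) point)"
    obtain y z y' z' where c: "c = ((y, z), (y', z'))" by (metis surj_pair)
    have G: "c \<in> ?G \<longleftrightarrow> y \<in> topspace (digits S) \<and> y' \<in> topspace (digits S) \<and>
        (\<exists>x \<in> topspace (space0 S). \<exists>x' \<in> topspace (space0 S).
          z = phi S n 0 (Pt0 x) \<and> z' = phi S n 0 (Pt0 x') \<and> proj S (y, x) = proj S (y', x'))"
      unfolding c by (auto simp: image_iff)
    have in0: "phi S n 0 (Pt0 x) \<in> topspace (tower S n)" if "x \<in> topspace (space0 S)" for x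
      using that S by (simp add: phi_in_tower tower_0_topspace)
    show "c \<in> (\<lambda>x. (x, x)) ` topspace P \<union> ?G \<longleftrightarrow>
      c \<in> {(a, b) \<in> topspace P \<times> topspace P. pi1 S n a = pi1 S n b}"
      unfolding Un_iff G using pi1_eq_pi1_iff[OF S, of y z n y' z'] in0
      by (auto simp: c P_def)
  qed
  finally show ?thesis .
qed

lemma tower_topological_invariant:
  assumes S: "similarity_scheme S"
  shows "compact_space (tower S n) \<and> Hausdorff_space (tower S n) \<and>
    compact_space (tower S (Suc n)) \<and> Hausdorff_space (tower S (Suc n)) \<and>
    continuous_map (space0 S) (tower S n) (\<lambda>x. phi S n 0 (Pt0 x)) \<and>
    quotient_map (prod_topology (digits S) (tower S n)) (tower S (Suc n)) (pi1 S n) \<and>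
    continuous_map (tower S n) (tower S (Suc n)) (phi1 S n)"
proof (induction n)
  case 0
  have *: "compact_space (space0 S)" "Hausdorff_space (space0 S)"
     "compact_space (space1 S)" "Hausdorff_space (space1 S)" "compact_space (digits S)"
     "continuous_map (space0 S) (space1 S) (embed S)"
     "continuous_map (prod_topology (digits S) (space0 S)) (space1 S) (proj S)"
    using S by (auto simp: similarity_scheme_def)
  have h0: "space0 S homeomorphic_space tower S 0" and h1: "space1 S homeomorphic_space tower S (Suc 0)"
    by (auto simp: tower.simps inj_on_def intro: homeomorphic_space_quotient_topology)
  have T: "compact_space (tower S 0)" "Hausdorff_space (tower S 0)"
    "compact_space (tower S (Suc 0))" "Hausdorff_space (tower S (Suc 0))"
    using * homeomorphic_compact_space[OF h0] homeomorphic_compact_space[OF h1]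
      homeomorphic_Hausdorff_space[OF h0] homeomorphic_Hausdorff_space[OF h1] by auto
  have q0: "quotient_map (space0 S) (tower S 0) Pt0"
    by (simp add: tower.simps quotient_map_quotient_topology)
  have c1: "continuous_map (space1 S) (tower S (Suc 0)) Pt1"
    by (simp add: tower.simps continuous_map_quotient_topology)
  have un0: "continuous_map (tower S 0) (space0 S) un0"
    by (rule continuous_compose_quotient_map[OF q0]) (simp add: o_def)
  have "continuous_map (prod_topology (digits S) (tower S 0)) (prod_topology (digits S) (space0 S))
      (\<lambda>(y, z). (y, un0 z))"
    using un0 by (auto simp: continuous_map_prod_top)
  from continuous_map_compose[OF continuous_map_compose[OF this *(7)] c1]
  have "continuous_map (prod_topology (digits S) (tower S 0)) (tower S (Suc 0)) (pi1 S 0)"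
    by (simp add: pi1.simps o_def case_prod_unfold)
  then have "quotient_map (prod_topology (digits S) (tower S 0)) (tower S (Suc 0)) (pi1 S 0)"
    using T * tower_Suc_topspace[OF S, of 0]
    by (intro continuous_imp_quotient_map) (auto simp: compact_space_prod_topology)
  moreover have "continuous_map (tower S 0) (tower S (Suc 0)) (phi1 S 0)"
    using continuous_map_compose[OF continuous_map_compose[OF un0 *(6)] c1]
    by (simp add: phi1.simps o_def)
  ultimately show ?case
    using T quotient_imp_continuous_map[OF q0] by simp
next
  case (Suc n)
  let ?P = "prod_topology (digits S) (tower S (Suc n))"
  have Y: "compact_space (digits S)" "Hausdorff_space (digits S)"
    using S by (auto simp: similarity_scheme_def)
  have \<phi>: "continuous_map (space0 S) (tower S (Suc n)) (\<lambda>x. phi S (Suc n) 0 (Pt0 x))"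
    using Suc.IH continuous_map_compose[of "space0 S" "tower S n" "\<lambda>x. phi S n 0 (Pt0 x)"
        "tower S (Suc n)" "phi1 S n"]
    by (simp add: phi_Suc o_def)
  have q: "quotient_map ?P (tower S (Suc (Suc n))) (pi1 S (Suc n))"
    by (simp add: tower.simps quotient_map_quotient_topology)
  have P: "compact_space ?P" "Hausdorff_space ?P"
    using Y Suc.IH by (auto simp: compact_space_prod_topology Hausdorff_space_prod_topology)
  have "Hausdorff_space (tower S (Suc (Suc n)))"
    by (rule Hausdorff_space_quotient_by_closed_kernel[OF P q closedin_kernel_pi1[OF S P(2) \<phi>]])
  moreover have "compact_space (tower S (Suc (Suc n)))"
    by (rule compact_space_quotient_map_image[OF P(1) q])
  moreover have "continuous_map (tower S (Suc n)) (tower S (Suc (Suc n))) (phi1 S (Suc n))"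
  proof (rule continuous_compose_quotient_map)
    show "quotient_map (prod_topology (digits S) (tower S n)) (tower S (Suc n)) (pi1 S n)"
      using Suc.IH by blast
    have "continuous_map (prod_topology (digits S) (tower S n)) ?P (\<lambda>(y, z). (y, phi1 S n z))"
      using Suc.IH by (auto simp: continuous_map_prod_top)
    from continuous_map_compose[OF this quotient_imp_continuous_map[OF q]]
    show "continuous_map (prod_topology (digits S) (tower S n)) (tower S (Suc (Suc n)))
        (phi1 S (Suc n) \<circ> pi1 S n)"
      by (rule continuous_map_eq) (auto simp: phi1_pi1[OF S])
  qed
  ultimately show ?case using Suc.IH \<phi> q by blast
qed

lemma compact_space_tower: "similarity_scheme S \<Longrightarrow> compact_space (tower S n)"
  and Hausdorff_space_tower: "similarity_scheme S \<Longrightarrow> Hausdorff_space (tower S n)"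
  and continuous_map_phi1: "similarity_scheme S \<Longrightarrow> continuous_map (tower S n) (tower S (Suc n)) (phi1 S n)"
  and quotient_map_pi1: "similarity_scheme S \<Longrightarrow>
    quotient_map (prod_topology (digits S) (tower S n)) (tower S (Suc n)) (pi1 S n)"
  using tower_topological_invariant by blast+

lemma continuous_map_phi:
  assumes "similarity_scheme S" "m \<le> n"
  shows "continuous_map (tower S m) (tower S n) (phi S n m)"
  using assms(2)
proof (induction n rule: dec_induct)
  case (step n)
  then have "phi S (Suc n) m = phi1 S n \<circ> phi S n m" by (auto simp: phi_Suc)
  then show ?case
    using step continuous_map_phi1[OF assms(1)] by (metis continuous_map_compose)
qed simp

section \<open>Cells\<close>

lemma pi_pq_Cons:
  "length ys = p \<Longrightarrow> pi_pq S (Suc p) q (y # ys) x = pi1 S (p + q) (y, pi_pq S p q ys x)"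
proof (induction p arbitrary: q ys x)
  case (Suc p)
  then have "ys \<noteq> []" "length (butlast ys) = p" by auto
  then show ?case
    using Suc.IH[of "butlast ys" "Suc q" "pi1 S q (last ys, x)"]
    by (simp only: pi_pq.simps butlast.simps last.simps if_False add_Suc_right add_Suc)
qed simp

lemma tower_cell_Nil: "tower_cell S [] = topspace (tower S 0)"
  by (simp add: tower_cell_def)

lemma tower_cell_Cons:
  "tower_cell S (y # ys) = (\<lambda>z. pi1 S (length ys) (y, z)) ` tower_cell S ys"
  by (simp add: tower_cell_def pi_pq_Cons image_image del: pi_pq.simps)

lemma tower_cell_subset:
  assumes "similarity_scheme S" "set ys \<subseteq> topspace (digits S)"
  shows "tower_cell S ys \<subseteq> topspace (tower S (length ys))"
  using assms(2)
  by (induction ys) (auto simp: tower_cell_Nil tower_cell_Cons intro!: pi1_in_tower assms(1))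

lemma closedin_tower_cell:
  assumes S: "similarity_scheme S" and "set ys \<subseteq> topspace (digits S)"
  shows "closedin (tower S (length ys)) (tower_cell S ys)"
  using assms(2)
proof (induction ys)
  case (Cons y ys)
  let ?n = "length ys"
  have "continuous_map (tower S ?n) (prod_topology (digits S) (tower S ?n)) (\<lambda>z. (y, z))"
    using Cons.prems by (auto simp: continuous_map_paired)
  from continuous_map_compose[OF this quotient_imp_continuous_map[OF quotient_map_pi1[OF S]]]
  have "continuous_map (tower S ?n) (tower S (Suc ?n)) (\<lambda>z. pi1 S ?n (y, z))"
    by (simp add: o_def)
  then have "closed_map (tower S ?n) (tower S (Suc ?n)) (\<lambda>z. pi1 S ?n (y, z))"
    using S by (simp add: continuous_imp_closed_map compact_space_tower Hausdorff_space_tower)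
  then show ?case using Cons by (simp add: closed_map_def tower_cell_Cons)
qed (simp add: tower_cell_Nil)

lemma tower_cell_parent:
  assumes S: "similarity_scheme S"
    and "z \<in> topspace (tower S (length ys))" "set (ys @ [y]) \<subseteq> topspace (digits S)"
    and "phi1 S (length ys) z \<in> tower_cell S (ys @ [y])"
  shows "z \<in> tower_cell S ys"
  using assms(2-)
proof (induction ys arbitrary: z)
  case Nil
  then show ?case by (simp add: tower_cell_Nil)
next
  case (Cons y1 ys)
  let ?n = "length ys"
  have ys: "set (ys @ [y]) \<subseteq> topspace (digits S)" "y1 \<in> topspace (digits S)"
    using Cons.prems by auto
  obtain y' z' where z: "z = pi1 S ?n (y', z')" and
    y': "y' \<in> topspace (digits S)" and z': "z' \<in> topspace (tower S ?n)"
    using Cons.prems(1) tower_Suc_topspace[OF S, of ?n] by auto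
  obtain w where w: "w \<in> tower_cell S (ys @ [y])" and
    eq: "pi1 S (Suc ?n) (y', phi1 S ?n z') = pi1 S (Suc ?n) (y1, w)"
    using Cons.prems(3) phi1_pi1[OF S y' z'] by (auto simp: tower_cell_Cons z)
  have wT: "w \<in> topspace (tower S (Suc ?n))"
    using tower_cell_subset[OF S ys(1)] w by auto
  have in0: "phi S ?n 0 (Pt0 x) \<in> topspace (tower S ?n)" if "x \<in> topspace (space0 S)" for x
    using that S by (simp add: phi_in_tower tower_0_topspace)
  from eq[unfolded pi1_eq_pi1_iff[OF S y' phi1_in_tower[OF S z'] ys(2) wT]]
  show ?case
  proof
    assume "(y', phi1 S ?n z') = (y1, w)"
    then show ?thesis using Cons.IH[OF z' ys(1)] w by (auto simp: z tower_cell_Cons)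
  next
    assume "\<exists>x \<in> topspace (space0 S). \<exists>x' \<in> topspace (space0 S). phi1 S ?n z' = phi S (Suc ?n) 0 (Pt0 x) \<and>
      w = phi S (Suc ?n) 0 (Pt0 x') \<and> proj S (y', x) = proj S (y1, x')"
    then obtain x x' where x: "x \<in> topspace (space0 S)" "x' \<in> topspace (space0 S)"
      and e: "phi1 S ?n z' = phi1 S ?n (phi S ?n 0 (Pt0 x))" "w = phi1 S ?n (phi S ?n 0 (Pt0 x'))"
      and p: "proj S (y', x) = proj S (y1, x')"
      by (auto simp: phi_Suc)
    have "z' = phi S ?n 0 (Pt0 x)"
      using e(1) phi1_inj_on[OF S] z' in0[OF x(1)] by (auto dest: inj_onD)
    then have "z = pi1 S ?n (y1, phi S ?n 0 (Pt0 x'))"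
      unfolding z using pi1_eq_pi1_iff[OF S y' z' ys(2) in0[OF x(2)]] x p by blast
    moreover have "phi S ?n 0 (Pt0 x') \<in> tower_cell S ys"
      using Cons.IH[OF in0[OF x(2)] ys(1)] w e(2) by simp
    ultimately show ?thesis by (auto simp: tower_cell_Cons)
  qed
qed

lemma tower_cell_Int_in_range_phi:
  assumes S: "similarity_scheme S"
    and "length a = n" "length b = n" "p \<le> n" "take p a \<noteq> take p b"
    and "set a \<subseteq> topspace (digits S)" "set b \<subseteq> topspace (digits S)"
    and "x \<in> tower_cell S a" "x \<in> tower_cell S b"
  shows "x \<in> phi S n p ` topspace (tower S p)"
  using assms(2-)
proof (induction p arbitrary: n a b x)
  case (Suc p)
  obtain m where m: "n = Suc m" "p \<le> m" using Suc.prems by (cases n) auto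
  obtain y a' y' b' where ab: "a = y # a'" "b = y' # b'"
    using Suc.prems m by (cases a; cases b) auto
  have Y: "y \<in> topspace (digits S)" "set a' \<subseteq> topspace (digits S)"
    "y' \<in> topspace (digits S)" "set b' \<subseteq> topspace (digits S)" and len: "length a' = m" "length b' = m"
    using Suc.prems ab m by auto
  obtain w w' where w: "w \<in> tower_cell S a'" "w' \<in> tower_cell S b'"
    and x: "x = pi1 S m (y, w)" "x = pi1 S m (y', w')"
    using Suc.prems len by (auto simp: ab tower_cell_Cons)
  have wT: "w \<in> topspace (tower S m)" "w' \<in> topspace (tower S m)"
    using w tower_cell_subset[OF S Y(2)] tower_cell_subset[OF S Y(4)] len by auto
  have "w \<in> phi S m p ` topspace (tower S p)"
  proof -
    from x have "pi1 S m (y, w) = pi1 S m (y', w')" by simp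
    then consider "y = y'" "w = w'" | x0 where "x0 \<in> topspace (space0 S)" "w = phi S m 0 (Pt0 x0)"
      unfolding pi1_eq_pi1_iff[OF S Y(1) wT(1) Y(3) wT(2)] by blast
    then show ?thesis
    proof cases
      case 1
      then have "take p a' \<noteq> take p b'" using Suc.prems(4) ab by simp
      with 1 Suc.IH[OF len m(2)] Y w show ?thesis by blast
    next
      case (2 x0)
      then have "phi S p 0 (Pt0 x0) \<in> topspace (tower S p)" "w = phi S m p (phi S p 0 (Pt0 x0))"
        using S m by (simp_all add: phi_in_tower tower_0_topspace phi_trans)
      then show ?thesis by blast
    qed
  qed
  then obtain z where z: "z \<in> topspace (tower S p)" "w = phi S m p z" by blast
  then have "x = phi S (Suc m) (Suc p) (pi1 S p (y, z))"
    using phi_pi1[OF S m(2) Y(1)] x by simp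
  then show ?case using pi1_in_tower[OF S Y(1) z(1)] m by blast
qed simp

section \<open>The relation on sequences\<close>

lemma seq_space_topspace: "u \<in> topspace (seq_space Y) \<longleftrightarrow> (\<forall>i. u i \<in> topspace Y)"
  by (auto simp: seq_space_def PiE_UNIV_domain)

lemma Gamma_set_phi1:
  assumes S: "similarity_scheme S" and z: "z \<in> topspace (tower S n)"
  shows "Gamma_set S (Suc n) (phi1 S n z) = Gamma_set S n z"
proof -
  have e: "phi S p (Suc n) (phi1 S n z) = phi S p n z" if "Suc n \<le> p" for p
    using phi_trans[of n "Suc n" p S z] that by (simp add: phi_Suc)
  have parent: "z \<in> tower_cell S (map u [0..<n])"
    if "u \<in> topspace (seq_space (digits S))" "phi1 S n z \<in> tower_cell S (map u [0..<Suc n])" for u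
    using tower_cell_parent[OF S, of z "map u [0..<n]" "u n"] z that
    by (auto simp: seq_space_topspace)
  show ?thesis
  proof (intro equalityI subsetI)
    fix u assume u: "u \<in> Gamma_set S (Suc n) (phi1 S n z)"
    have "phi S p n z \<in> tower_cell S (map u [0..<p])" if "n \<le> p" for p
    proof (cases "p = n")
      case True
      have "phi S (Suc n) (Suc n) (phi1 S n z) \<in> tower_cell S (map u [0..<Suc n])"
        using u unfolding Gamma_set_def by blast
      with True show ?thesis using u parent by (simp add: Gamma_set_def)
    next
      case False
      with that have "Suc n \<le> p" by simp
      with u e show ?thesis unfolding Gamma_set_def by force
    qed
    with u show "u \<in> Gamma_set S n z" by (simp add: Gamma_set_def)
  next
    fix u assume "u \<in> Gamma_set S n z"
    with e show "u \<in> Gamma_set S (Suc n) (phi1 S n z)" by (simp add: Gamma_set_def)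
  qed
qed

lemma Gamma_set_phi:
  assumes S: "similarity_scheme S" and "m \<le> n" and z: "z \<in> topspace (tower S m)"
  shows "Gamma_set S n (phi S n m z) = Gamma_set S m z"
  using \<open>m \<le> n\<close>
  by (induction n rule: dec_induct) (simp_all add: S z phi_Suc phi_in_tower Gamma_set_phi1)

lemma Gamma_set_shift_in:
  assumes S: "similarity_scheme S" and "y \<in> topspace (digits S)" "z \<in> topspace (tower S n)"
    and u: "u \<in> Gamma_set S n z"
  shows "shift_in y u \<in> Gamma_set S (Suc n) (pi1 S n (y, z))"
proof -
  have "phi S p (Suc n) (pi1 S n (y, z)) \<in> tower_cell S (map (shift_in y u) [0..<p])" if le: "Suc n \<le> p" for p
  proof -
    obtain q where p: "p = Suc q" "n \<le> q" using le by (cases p) auto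
    have "map (shift_in y u) [0..<Suc q] = y # map u [0..<q]"
      by (simp add: map_upt_Suc shift_in_def del: upt_Suc)
    then show ?thesis
      using u p phi_pi1[OF S p(2) assms(2,3)] by (auto simp: Gamma_set_def tower_cell_Cons simp del: upt_Suc)
  qed
  moreover have "shift_in y u \<in> topspace (seq_space (digits S))"
    using u assms(2) by (auto simp: Gamma_set_def seq_space_topspace shift_in_def split: nat.split)
  ultimately show ?thesis by (simp add: Gamma_set_def)
qed

lemma rel_R_shift_in:
  assumes S: "similarity_scheme S" and y: "y \<in> topspace (digits S)" and "(u, v) \<in> rel_R S"
  shows "(shift_in y u, shift_in y v) \<in> rel_R S"
proof -
  have "shift_in y w \<in> topspace (seq_space (digits S))" if "w \<in> topspace (seq_space (digits S))" for w
    using that y by (auto simp: seq_space_topspace shift_in_def split: nat.split)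
  then show ?thesis
    using assms(3) Gamma_set_shift_in[OF S y] pi1_in_tower[OF S y] unfolding rel_R_def by blast
qed

lemma rel_R_subset_rel_R_inf: "rel_R S \<subseteq> rel_R_inf S"
  by (auto simp: rel_R_inf_def)

lemma pi_seq_eq_iff:
  assumes "u \<in> topspace (seq_space (digits S))" "v \<in> topspace (seq_space (digits S))"
  shows "pi_seq S u = pi_seq S v \<longleftrightarrow> (u, v) \<in> rel_R_inf S"
  unfolding pi_seq_def using eq_equiv_class_iff[OF equiv_rel_R_inf assms] .

lemma phi_inf_eq_pi_seq:
  assumes "x \<in> topspace (tower S n)" "v \<in> Gamma_set S n x"
  shows "phi_inf S n x = pi_seq S v"
proof -
  have "pi_seq S u = pi_seq S v" if "u \<in> Gamma_set S n x" for u
  proof -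
    have "u \<in> topspace (seq_space (digits S))" "v \<in> topspace (seq_space (digits S))"
      using that assms by (auto simp: Gamma_set_def)
    moreover from this have "(u, v) \<in> rel_R S"
      using that assms by (auto simp: rel_R_def)
    ultimately show ?thesis using rel_R_subset_rel_R_inf pi_seq_eq_iff by blast
  qed
  then have "pi_seq S ` Gamma_set S n x = {pi_seq S v}" using assms by blast
  then show ?thesis by (simp add: phi_inf_def)
qed

lemma rel_R_inf_eq_rel_R:
  assumes S: "similarity_scheme S" and inj: "fully_injective S"
  shows "rel_R_inf S = rel_R S"
proof
  have "trans (rel_R S)"
  proof (rule transI)
    fix u v w assume uv: "(u, v) \<in> rel_R S" and vw: "(v, w) \<in> rel_R S"
    show "(u, w) \<in> rel_R S"
    proof (cases "u = v \<or> v = w")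
      case False
      then obtain n x m x' where x: "x \<in> topspace (tower S n)" "u \<in> Gamma_set S n x" "v \<in> Gamma_set S n x"
        and x': "x' \<in> topspace (tower S m)" "v \<in> Gamma_set S m x'" "w \<in> Gamma_set S m x'"
        using uv vw unfolding rel_R_def by blast
      let ?k = "max n m"
      let ?z = "phi S ?k n x" and ?z' = "phi S ?k m x'"
      have T: "?z \<in> topspace (tower S ?k)" "?z' \<in> topspace (tower S ?k)"
        and G: "Gamma_set S ?k ?z = Gamma_set S n x" "Gamma_set S ?k ?z' = Gamma_set S m x'"
        using x x' S by (simp_all add: phi_in_tower Gamma_set_phi)
      have "phi_inf S ?k ?z = phi_inf S ?k ?z'"
        using phi_inf_eq_pi_seq[OF T(1), of v] phi_inf_eq_pi_seq[OF T(2), of v] G x x' by simp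
      then have "?z = ?z'"
        using inj T unfolding fully_injective_def by (meson inj_onD)
      then have "w \<in> Gamma_set S n x" using G x' by simp
      then show ?thesis using x uv vw unfolding rel_R_def by blast
    qed (use uv vw in auto)
  qed
  moreover have "sym (rel_R S)" unfolding rel_R_def sym_def by blast
  moreover have "refl_on (topspace (seq_space (digits S))) (rel_R S)"
    unfolding rel_R_def refl_on_def by blast
  moreover have "rel_R S \<subseteq> topspace (seq_space (digits S)) \<times> topspace (seq_space (digits S))"
    unfolding rel_R_def by blast
  ultimately show "rel_R_inf S \<subseteq> rel_R S"
    unfolding rel_R_inf_def by (intro Inter_lower) (simp add: equiv_def)
qed (rule rel_R_subset_rel_R_inf)

section \<open>Closedness for discrete digits\<close>

lemma openin_cylinder:
  "openin (seq_space (discrete_topology A))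
     {v \<in> topspace (seq_space (discrete_topology A)). map v [0..<p] = map u [0..<p]}"
proof -
  let ?Z = "seq_space (discrete_topology A)"
  let ?U = "\<lambda>i. if i < p then A \<inter> {u i} else A"
  have "{i. ?U i \<noteq> topspace (discrete_topology A)} \<subseteq> {..<p}" by auto
  then have "finite {i. ?U i \<noteq> topspace (discrete_topology A)}"
    using finite_subset by blast
  then have "openin ?Z (PiE UNIV ?U)"
    unfolding seq_space_def by (intro product_topology_basis) auto
  also have "PiE UNIV ?U = {v \<in> topspace ?Z. map v [0..<p] = map u [0..<p]}"
    by (auto simp: seq_space_topspace PiE_UNIV_domain Pi_iff split: if_splits)
  finally show ?thesis .
qed

lemma closedin_graph_Gamma_set:
  assumes S: "similarity_scheme S" and Y: "digits S = discrete_topology A"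
  shows "closedin (prod_topology (tower S n) (seq_space (digits S)))
    {(x, u). x \<in> topspace (tower S n) \<and> u \<in> Gamma_set S n x}"
proof -
  let ?Z = "seq_space (digits S)" and ?X = "tower S n"
  define G where "G p = {(x, u) \<in> topspace ?X \<times> topspace ?Z.
    phi S p n x \<in> tower_cell S (map u [0..<p])}" for p
  have "closedin (prod_topology ?X ?Z) (G p)" if "n \<le> p" for p
  proof -
    have "openin (prod_topology ?X ?Z) (topspace (prod_topology ?X ?Z) - G p)"
    proof (subst openin_subopen, safe)
      fix x u assume xu: "(x, u) \<in> topspace (prod_topology ?X ?Z)" "(x, u) \<notin> G p"
      let ?w = "map u [0..<p]"
      let ?V = "{v \<in> topspace ?Z. map v [0..<p] = ?w}"
      let ?U = "{x \<in> topspace ?X. phi S p n x \<in> topspace (tower S p) - tower_cell S ?w}"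
      have "closedin (tower S p) (tower_cell S ?w)"
        using closedin_tower_cell[OF S, of ?w] xu by (auto simp: seq_space_topspace)
      then have "openin ?X ?U"
        using continuous_map_phi[OF S \<open>n \<le> p\<close>] by (intro openin_continuous_map_preimage) auto
      moreover have "openin ?Z ?V"
        unfolding Y by (rule openin_cylinder)
      ultimately have "openin (prod_topology ?X ?Z) (?U \<times> ?V)"
        by (simp add: openin_prod_Times_iff)
      moreover have "(x, u) \<in> ?U \<times> ?V"
        using xu phi_in_tower[OF S \<open>n \<le> p\<close>] by (auto simp: G_def)
      moreover have "?U \<times> ?V \<subseteq> topspace (prod_topology ?X ?Z) - G p"
        by (auto simp: G_def simp del: map_eq_conv)
      ultimately show "\<exists>T. openin (prod_topology ?X ?Z) T \<and> (x, u) \<in> T \<and>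
          T \<subseteq> topspace (prod_topology ?X ?Z) - G p" by blast
    qed
    then show ?thesis by (auto simp: closedin_def G_def)
  qed
  then have "closedin (prod_topology ?X ?Z) (\<Inter>p\<in>{n..}. G p)"
    by (intro closedin_INT) auto
  also have "(\<Inter>p\<in>{n..}. G p) = {(x, u). x \<in> topspace ?X \<and> u \<in> Gamma_set S n x}"
    by (auto simp: G_def Gamma_set_def)
  finally show ?thesis .
qed

lemma closedin_rel_R_level:
  assumes S: "similarity_scheme S" and Y: "digits S = discrete_topology A"
  shows "closedin (prod_topology (seq_space (digits S)) (seq_space (digits S)))
    {(u, v). \<exists>x \<in> topspace (tower S n). u \<in> Gamma_set S n x \<and> v \<in> Gamma_set S n x}"
proof -
  let ?Z = "seq_space (digits S)" and ?X = "tower S n"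
  let ?G = "{(x, u). x \<in> topspace ?X \<and> u \<in> Gamma_set S n x}"
  let ?W = "prod_topology ?X (prod_topology ?Z ?Z)"
  define D where "D = {(x, u, v). x \<in> topspace ?X \<and> u \<in> Gamma_set S n x \<and> v \<in> Gamma_set S n x}"
  have "closedin ?W {c \<in> topspace ?W. (fst c, fst (snd c)) \<in> ?G}"
    by (rule closedin_continuous_map_preimage[OF _ closedin_graph_Gamma_set[OF S Y]])
      (intro continuous_map_pairedI continuous_map_fst
        continuous_map_compose[OF continuous_map_snd continuous_map_fst, unfolded o_def])
  moreover have "closedin ?W {c \<in> topspace ?W. (fst c, snd (snd c)) \<in> ?G}"
    by (rule closedin_continuous_map_preimage[OF _ closedin_graph_Gamma_set[OF S Y]])
      (intro continuous_map_pairedI continuous_map_fst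
        continuous_map_compose[OF continuous_map_snd continuous_map_snd, unfolded o_def])
  ultimately have "closedin ?W ({c \<in> topspace ?W. (fst c, fst (snd c)) \<in> ?G} \<inter>
      {c \<in> topspace ?W. (fst c, snd (snd c)) \<in> ?G})"
    by (rule closedin_Int)
  also have "{c \<in> topspace ?W. (fst c, fst (snd c)) \<in> ?G} \<inter>
      {c \<in> topspace ?W. (fst c, snd (snd c)) \<in> ?G} = D"
    by (auto simp: D_def Gamma_set_def)
  finally have "closedin (prod_topology ?Z ?Z) (snd ` D)"
    using Abstract_Topological_Spaces.closed_map_snd[OF compact_space_tower[OF S]]
    unfolding closed_map_def by blast
  also have "snd ` D = {(u, v). \<exists>x \<in> topspace ?X. u \<in> Gamma_set S n x \<and> v \<in> Gamma_set S n x}"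
    unfolding D_def image_def by auto
  finally show ?thesis .
qed

lemma rel_R_at_level:
  assumes S: "similarity_scheme S" and uv: "(u, v) \<in> rel_R S"
    and ne: "map u [0..<p] \<noteq> map v [0..<p]"
  shows "\<exists>x \<in> topspace (tower S p). u \<in> Gamma_set S p x \<and> v \<in> Gamma_set S p x"
proof -
  have Z: "u \<in> topspace (seq_space (digits S))" "v \<in> topspace (seq_space (digits S))"
    using uv by (auto simp: rel_R_def)
  obtain n x where x: "x \<in> topspace (tower S n)" "u \<in> Gamma_set S n x" "v \<in> Gamma_set S n x"
    using uv ne unfolding rel_R_def by blast
  let ?m = "max n p"
  let ?x = "phi S ?m n x"
  have G: "Gamma_set S ?m ?x = Gamma_set S n x"
    using x S by (simp add: Gamma_set_phi)
  then have "phi S ?m ?m ?x \<in> tower_cell S (map u [0..<?m])"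
    "phi S ?m ?m ?x \<in> tower_cell S (map v [0..<?m])"
    using x unfolding Gamma_set_def by blast+
  then have "?x \<in> phi S ?m p ` topspace (tower S p)"
    using Z ne by (intro tower_cell_Int_in_range_phi[OF S, of "map u [0..<?m]" _ "map v [0..<?m]"])
      (auto simp: seq_space_topspace take_map take_upt)
  then obtain z where z: "z \<in> topspace (tower S p)" "?x = phi S ?m p z" by blast
  then have "Gamma_set S p z = Gamma_set S n x"
    using G S by (simp add: Gamma_set_phi)
  then show ?thesis using z x by blast
qed

lemma closedin_rel_R:
  assumes S: "similarity_scheme S" and Y: "digits S = discrete_topology A"
  shows "closedin (prod_topology (seq_space (digits S)) (seq_space (digits S))) (rel_R S)"
proof -
  let ?Z = "seq_space (digits S)"
  let ?R = "\<lambda>p. {(u, v). \<exists>x \<in> topspace (tower S p). u \<in> Gamma_set S p x \<and> v \<in> Gamma_set S p x}"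
  have "openin (prod_topology ?Z ?Z) (topspace (prod_topology ?Z ?Z) - rel_R S)"
  proof (subst openin_subopen, safe)
    fix u v assume uv: "(u, v) \<in> topspace (prod_topology ?Z ?Z)" "(u, v) \<notin> rel_R S"
    then have "u \<noteq> v" by (auto simp: rel_R_def)
    then obtain i where "u i \<noteq> v i" by blast
    let ?p = "Suc i"
    have ne: "map u [0..<?p] \<noteq> map v [0..<?p]" using \<open>u i \<noteq> v i\<close> by auto
    let ?C = "\<lambda>u. {v \<in> topspace ?Z. map v [0..<?p] = map u [0..<?p]}"
    let ?T = "?C u \<times> ?C v - ?R ?p"
    have "openin ?Z (?C u)" "openin ?Z (?C v)"
      unfolding Y by (rule openin_cylinder)+
    then have "openin (prod_topology ?Z ?Z) (?C u \<times> ?C v)"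
      by (simp add: openin_prod_Times_iff)
    then have "openin (prod_topology ?Z ?Z) ?T"
      by (rule openin_diff[OF _ closedin_rel_R_level[OF S Y]])
    moreover have "(u, v) \<in> ?T" using uv by (auto simp: rel_R_def)
    moreover have "?T \<subseteq> topspace (prod_topology ?Z ?Z) - rel_R S"
    proof
      fix c assume c: "c \<in> ?T"
      obtain u' v' where c': "c = (u', v')" by fastforce
      then have "map u' [0..<?p] \<noteq> map v' [0..<?p]" using c ne by auto
      then have "(u', v') \<notin> rel_R S" using c c' rel_R_at_level[OF S, of u' v' ?p] by blast
      then show "c \<in> topspace (prod_topology ?Z ?Z) - rel_R S" using c c' by auto
    qed
    ultimately show "\<exists>T. openin (prod_topology ?Z ?Z) T \<and> (u, v) \<in> T \<and>
        T \<subseteq> topspace (prod_topology ?Z ?Z) - rel_R S" by blast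
  qed
  then show ?thesis by (auto simp: closedin_def rel_R_def)
qed

lemma continuous_map_shift_in:
  assumes "k \<in> topspace Y"
  shows "continuous_map (seq_space Y) (seq_space Y) (shift_in k)"
proof -
  have "continuous_map (seq_space Y) Y (\<lambda>u. shift_in k u i)" for i
    using assms by (cases i) (auto simp: shift_in_def seq_space_def intro: continuous_map_product_projection)
  then show ?thesis
    unfolding seq_space_def[of Y] by (subst continuous_map_componentwise_UNIV) (simp add: seq_space_def)
qed

theorem corollary6p3:
  fixes S :: "('a, 'b, nat) scheme" and N :: nat
  assumes "similarity_scheme S"
    and "digits S = discrete_topology {1..N}"
    and "fully_injective S"
  shows "topological_self_similar_set (limit_space S) \<and>
         self_similar_via N (limit_space S) (pi_seq S)"
proof -
  note S = assms(1) and Y = assms(2)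
  let ?Z = "seq_space (digits S)"
  have q: "quotient_map ?Z (limit_space S) (pi_seq S)"
    by (simp add: limit_space_def quotient_map_quotient_topology)
  have Z: "compact_space ?Z" "Hausdorff_space ?Z"
    by (auto simp: seq_space_def Y compact_space_product_topology Hausdorff_space_product_topology
        compact_space_discrete_topology)
  have pi_eq: "pi_seq S u = pi_seq S v \<longleftrightarrow> (u, v) \<in> rel_R S"
    if "u \<in> topspace ?Z" "v \<in> topspace ?Z" for u v
    using pi_seq_eq_iff[OF that] by (simp add: rel_R_inf_eq_rel_R S assms(3))
  have "{(u, v) \<in> topspace ?Z \<times> topspace ?Z. pi_seq S u = pi_seq S v} = rel_R S"
    using pi_eq by (auto simp: rel_R_def)
  then have "Hausdorff_space (limit_space S)"
    using closedin_rel_R[OF S Y] by (intro Hausdorff_space_quotient_by_closed_kernel[OF Z q]) simp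
  moreover have "compact_space (limit_space S)"
    by (rule compact_space_quotient_map_image[OF Z(1) q])
  moreover have "\<exists>f. continuous_map (limit_space S) (limit_space S) f \<and>
      (\<forall>u \<in> topspace ?Z. pi_seq S (shift_in k u) = f (pi_seq S u))" if "k \<in> {1..N}" for k
  proof -
    have k: "k \<in> topspace (digits S)" using that Y by simp
    have s: "continuous_map ?Z ?Z (shift_in k)" by (rule continuous_map_shift_in[OF k])
    then have sZ: "shift_in k u \<in> topspace ?Z" if "u \<in> topspace ?Z" for u
      using that by (auto simp: continuous_map_def)
    have "continuous_map ?Z (limit_space S) (pi_seq S \<circ> shift_in k)"
      by (rule continuous_map_compose[OF s quotient_imp_continuous_map[OF q]])
    then obtain f where "continuous_map (limit_space S) (limit_space S) f"
      "\<And>u. u \<in> topspace ?Z \<Longrightarrow> f (pi_seq S u) = (pi_seq S \<circ> shift_in k) u"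
      by (rule quotient_map_lift_exists[OF q]) (auto simp: pi_eq sZ rel_R_shift_in[OF S k])
    then show ?thesis by fastforce
  qed
  then have "\<exists>f. \<forall>k\<in>{1..N}. continuous_map (limit_space S) (limit_space S) (f k) \<and>
      (\<forall>u \<in> topspace ?Z. pi_seq S (shift_in k u) = f k (pi_seq S u))"
    by metis
  ultimately have "self_similar_via N (limit_space S) (pi_seq S)"
    using quotient_imp_continuous_map[OF q] quotient_imp_surjective_map[OF q]
    unfolding self_similar_via_def Y by blast
  then show ?thesis unfolding topological_self_similar_set_def by blast
qed

end
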